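(* Let $d \geq 3$, $p>1$, $s \in (0,1)$ and let $k \in \mathbb{N}$ with $1<k<d$. Let $\alpha, \beta \in \mathbb{R}$ be such that $sp = k+\alpha+\beta$. Let $K = \{x=(x_k,x_{d-k}) \in \mathbb{R}^k \times \mathbb{R}^{d-k} : x_k = 0\}$. Then there exists a constant $C=C(d,s,p,\alpha,\beta)>0$ such that for every $R>0$ and every $u \in C^1_c(\mathbb{R}^d \setminus K)$ satisfying $\operatorname{supp}(u) \subset B^k(0,R) \times \mathbb{R}^{d-k}$, $$\int_{\mathbb{R}^{d}} \frac{|u(x)|^{p}}{|x_{k}|^{k} \ln^{p} \left( \frac{4R}{|x_{k}|} \right)}\, dx \leq C \int_{\mathbb{R}^{d}} \int_{\mathbb{R}^{d}} \frac{|u(x)-u(y)|^{p}}{|x-y|^{d+sp}} |x_{k}|^{\alpha} |y_{k}|^{\beta}\, dx\,dy.$$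
   Context: Every $x\in\mathbb{R}^d$ is written $x=(x_k,x_{d-k})$ with $x_k\in\mathbb{R}^k$ and $x_{d-k}\in\mathbb{R}^{d-k}$ (so $x_k$ denotes the block of the first $k$ coordinates, not a single coordinate); likewise $y=(y_k,y_{d-k})$. $B^k(0,R)$ is the open ball of radius $R$ centered at $0$ in $\mathbb{R}^k$. $C^1_c(\mathbb{R}^d\setminus K)$ is the space of real-valued $C^1$ functions with compact support contained in $\mathbb{R}^d\setminus K$, extended by zero to $\mathbb{R}^d$. $\ln^p(t)$ means $(\ln t)^p$. *)

theory Defs
  imports "HOL-Analysis.Analysis"
begin

definition supp :: "('a::topological_space \<Rightarrow> real) \<Rightarrow> 'a set" where
  "supp u = closure {x. u x \<noteq> 0}"

definition C1_on :: "'a::real_normed_vector set \<Rightarrow> ('a \<Rightarrow> real) \<Rightarrow> bool" where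
  "C1_on S u \<longleftrightarrow>
     (\<exists>u' :: 'a \<Rightarrow> 'a \<Rightarrow>\<^sub>L real.
        (\<forall>x\<in>S. (u has_derivative blinfun_apply (u' x)) (at x)) \<and> continuous_on S u')"

text \<open>Intended for open \<open>S\<close>. Elements are functions on the whole space; the support condition
  forces them to vanish outside \<open>S\<close>, i.e. they are extended by zero.\<close>

definition C1c :: "'a::real_normed_vector set \<Rightarrow> ('a \<Rightarrow> real) set" where
  "C1c S = {u. C1_on S u \<and> compact (supp u) \<and> supp u \<subseteq> S}"

text \<open>The space $\mathbb{R}^d$ is \<open>(real^'k) \<times> (real^'m)\<close>, with \<open>fst x\<close> and \<open>snd x\<close> the blocks $x_k$
  and $x_{d-k}$. The norm of the product type is the Euclidean norm of $\mathbb{R}^d$ and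
  \<open>lborel\<close> is its Lebesgue measure.\<close>

definition sing_set :: "((real^'k) \<times> (real^'m)) set" where
  "sing_set = {x. fst x = 0}"

end

theory Submission
  imports Defs
begin

text \<open>Let \<open>a\<^sub>j\<close> be the integral of \<open>\<bar>u\<bar>\<^sup>p\<close> over the shell \<open>r\<^sub>j / 2 \<le> \<bar>x\<^sub>k\<bar> < r\<^sub>j\<close>, \<open>r\<^sub>j = 2R / 2\<^sup>j\<close>,
  divided by \<open>r\<^sub>j\<^sup>k\<close>. Two consecutive shells are coupled by choosing \<open>x\<^sub>k\<close> and \<open>y\<^sub>k\<close> independently
  and the remaining coordinates at distance less than \<open>r\<^sub>j\<close>. The marginals of this coupling are
  exactly uniform, so convexity of the \<open>p\<close>-th power gives, for all \<open>0 < t < 1\<close>,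
  \<open>a\<^sub>j\<^sub>+\<^sub>1 \<le> (1-t)\<^sup>1\<^sup>-\<^sup>p a\<^sub>j + t\<^sup>1\<^sup>-\<^sup>p K E\<^sub>j\<close>, where \<open>E\<^sub>j\<close> is the part of the double integral that lives
  on the coupled pairs; the powers of \<open>r\<^sub>j\<close> cancel because \<open>sp = k + \<alpha> + \<beta>\<close>. The factor of \<open>a\<^sub>j\<close>
  tends to 1 as \<open>t\<close> tends to 0, so the choice \<open>t = 1 / (2 (j + 2))\<close> and the weights \<open>(j + 1)\<^sup>1\<^sup>-\<^sup>p\<close>
  make the estimates telescope and leave \<open>(j + 1)\<^sup>-\<^sup>p a\<^sub>j\<close> on the left. Finally \<open>a\<^sub>0 = 0\<close> by the
  support condition, and the logarithm is at least \<open>(j + 1) ln 2\<close> on the \<open>j\<close>-th shell.\<close>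

section \<open>Inequalities for real powers\<close>

text \<open>Convexity of the \<open>p\<close>-th power at the points |a|/(1-t) and |a-b|/t with
  weights 1-t and t, after |b| <= |a| + |a-b|. The parameter \<open>t\<close> is left free so that
  the factor of |a|^p can be brought as close to 1 as a given shell requires.\<close>

lemma abs_powr_split_le:
  fixes a b p t :: real
  assumes "p \<ge> 1" "0 < t" "t < 1"
  shows "\<bar>b\<bar> powr p \<le> (1 - t) powr (1 - p) * \<bar>a\<bar> powr p + t powr (1 - p) * \<bar>a - b\<bar> powr p"
proof -
  have scale: "l * (c / l) powr p = l powr (1 - p) * c powr p" if "l > 0" "c \<ge> 0" for l c :: real
    using that by (simp add: powr_divide powr_diff)
  have ge1: "l powr (1 - p) \<ge> 1" if "0 < l" "l < 1" for l :: real
    using that assms powr_mono'[of "1 - p" 0 l] by simp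
  \<comment> \<open>If one of the two points is 0, at most one term on the right survives, and its
    factor is at least 1 because the exponent 1-p is nonpositive.\<close>
  consider "a = 0" | "a = b" | "a \<noteq> 0" "a \<noteq> b" by blast
  then show ?thesis
  proof cases
    case 1
    then show ?thesis using ge1[of t] assms mult_right_mono[of 1 "t powr (1 - p)" "\<bar>b\<bar> powr p"] by simp
  next
    case 2
    then show ?thesis
      using ge1[of "1 - t"] assms mult_right_mono[of 1 "(1 - t) powr (1 - p)" "\<bar>b\<bar> powr p"] by simp
  next
    case 3
    have "\<bar>b\<bar> powr p \<le> ((1 - t) * (\<bar>a\<bar> / (1 - t)) + t * (\<bar>a - b\<bar> / t)) powr p"
      using assms by (intro powr_mono2) auto
    also have "\<dots> \<le> (1 - t) * (\<bar>a\<bar> / (1 - t)) powr p + t * (\<bar>a - b\<bar> / t) powr p"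
      using convex_onD[OF powr_convex[OF assms(1)], of t "\<bar>a\<bar> / (1 - t)" "\<bar>a - b\<bar> / t"] 3 assms
      by simp
    also have "\<dots> = (1 - t) powr (1 - p) * \<bar>a\<bar> powr p + t powr (1 - p) * \<bar>a - b\<bar> powr p"
      using assms by (simp add: scale)
    finally show ?thesis .
  qed
qed

text \<open>Mean value theorem on [n, n+1/2]; the intermediate point satisfies z <= n + 1/2 <= 3n/2.
  The term of order n^(-p) is the gain of one telescoping step.\<close>

lemma powr_minus_shift_half_le:
  fixes p n :: real
  assumes "p > 1" "n \<ge> 1"
  shows "(n + 1/2) powr (1 - p) + (p - 1) / 2 * (3/2) powr (- p) * n powr (- p) \<le> n powr (1 - p)"
proof -
  have "\<exists>z>n. z < n + 1/2 \<and> (n + 1/2) powr (1 - p) - n powr (1 - p) = (n + 1/2 - n) * ((1 - p) * z powr (- p))"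
    using assms has_real_derivative_powr[of _ "1 - p"] by (intro MVT2) auto
  then obtain z where z: "n < z" "z < n + 1/2"
    "n powr (1 - p) - (n + 1/2) powr (1 - p) = (p - 1) / 2 * z powr (- p)"
    by (auto simp: algebra_simps)
  have "(3/2) powr (- p) * n powr (- p) = (3/2 * n) powr (- p)"
    using assms by (subst powr_mult) auto
  also have "\<dots> \<le> z powr (- p)"
    using assms z by (intro powr_mono2') auto
  finally have "(p - 1) / 2 * ((3/2) powr (- p) * n powr (- p)) \<le> (p - 1) / 2 * z powr (- p)"
    using assms by (intro mult_left_mono) auto
  then show ?thesis using z by (simp add: mult.assoc)
qed

text \<open>The ratio c/r lies in [l, 1], so its \<open>a\<close>-th power is at least its |a|-th
  power, which is at least l^|a|. The absolute value serves both signs of a weight exponent.\<close>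

lemma powr_ge_of_ratio_bounds:
  fixes a c r l :: real
  assumes "0 < r" "0 < l" "l \<le> 1" "l * r \<le> c" "c \<le> r"
  shows "l powr \<bar>a\<bar> * r powr a \<le> c powr a"
proof -
  have "0 < l * r" using assms by simp
  then have c: "0 < c" using assms(4) by linarith
  have ratio: "l \<le> c / r" "c / r \<le> 1" "c / r > 0"
    using assms c by (auto simp: field_simps)
  have "l powr \<bar>a\<bar> \<le> (c / r) powr \<bar>a\<bar>"
    using assms ratio by (intro powr_mono2) auto
  also have "\<dots> \<le> (c / r) powr a"
    using ratio by (intro powr_mono') auto
  finally show ?thesis
    using assms c by (simp add: powr_divide field_simps)
qed

section \<open>A discrete logarithmic Hardy inequality\<close>

text \<open>With \<open>t\<close> tuned to \<open>j\<close>, each weighted step leaves a surplus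
  \<open>w j * a j\<close>, and the surpluses add up to the left-hand side. Nothing is subtracted in
  \<open>ennreal\<close>: the surpluses are carried on the left throughout.\<close>

lemma discrete_log_hardy:
  fixes a g :: "nat \<Rightarrow> ennreal" and p :: real
  assumes "p > 1" "a 0 = 0"
    and step: "\<And>j t. 0 < t \<Longrightarrow> t < 1 \<Longrightarrow>
      a (Suc j) \<le> ennreal ((1 - t) powr (1 - p)) * a j + ennreal (t powr (1 - p)) * g j"
  shows "ennreal ((p - 1) / 2 * (3/2) powr (- p)) * (\<Sum>j. ennreal (real (Suc j) powr (- p)) * a j)
    \<le> ennreal (2 powr (p - 1)) * (\<Sum>j. g j)"
proof -
  define c where "c = (p - 1) / 2 * (3/2) powr (- p)"
  define v where "v j = real (Suc j) powr (1 - p)" for j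
  define w where "w j = c * real (Suc j) powr (- p)" for j
  have c: "c \<ge> 0" using assms by (simp add: c_def)
  have w: "w j \<ge> 0" for j using c by (simp add: w_def)
  have telescope: "ennreal (v (Suc j)) * a (Suc j) + ennreal (w j) * a j
      \<le> ennreal (v j) * a j + ennreal (2 powr (p - 1)) * g j" for j
  proof -
    define n where "n = real (Suc j)"
    \<comment> \<open>This makes (n+1)(1-t) equal to n + 1/2: the half step from n+1 absorbs the
      convexity factor, and the half step from there down to n pays for \<open>w j\<close>. As
      (n+1)t = 1/2, the coefficient of \<open>g j\<close> does not depend on
      \<open>j\<close>.\<close>
    define t where "t = 1 / (2 * (n + 1))"
    have n: "n \<ge> 1" by (simp add: n_def)
    have t: "0 < t" "t < 1" using n by (auto simp: t_def field_simps)
    have vS: "v (Suc j) = (n + 1) powr (1 - p)" by (simp add: v_def n_def add.commute)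
    have nt: "(n + 1) * (1 - t) = n + 1/2" "(n + 1) * t = 1/2" using n by (auto simp: t_def field_simps)
    have A: "v (Suc j) * (1 - t) powr (1 - p) + w j \<le> v j"
    proof -
      have "v (Suc j) * (1 - t) powr (1 - p) = (n + 1/2) powr (1 - p)"
        unfolding vS nt(1)[symmetric] using n t by (subst powr_mult) auto
      then show ?thesis
        using powr_minus_shift_half_le[OF assms(1) n] by (simp add: v_def w_def c_def n_def)
    qed
    have B: "v (Suc j) * t powr (1 - p) = 2 powr (p - 1)"
    proof -
      have "v (Suc j) * t powr (1 - p) = (1/2) powr (1 - p)"
        unfolding vS nt(2)[symmetric] using n t by (subst powr_mult) auto
      also have "\<dots> = 2 powr (p - 1)"
        using powr_minus_divide[of 2 "1 - p"] by (simp add: powr_divide)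
      finally show ?thesis .
    qed
    have "ennreal (v (Suc j)) * a (Suc j) + ennreal (w j) * a j
      \<le> ennreal (v (Suc j)) * (ennreal ((1 - t) powr (1 - p)) * a j + ennreal (t powr (1 - p)) * g j)
        + ennreal (w j) * a j"
      by (intro add_right_mono mult_left_mono step t) auto
    also have "\<dots> = ennreal (v (Suc j) * (1 - t) powr (1 - p) + w j) * a j
        + ennreal (v (Suc j) * t powr (1 - p)) * g j"
      using w[of j] by (subst ennreal_plus) (simp_all add: v_def ennreal_mult algebra_simps)
    also have "\<dots> \<le> ennreal (v j) * a j + ennreal (2 powr (p - 1)) * g j"
      unfolding B by (intro add_right_mono mult_right_mono ennreal_leI A) auto
    finally show ?thesis .
  qed
  \<comment> \<open>The boundary term \<open>v N * a N\<close> carries the induction and is dropped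
    afterwards; for N = 0 it vanishes by \<open>a 0 = 0\<close>.\<close>
  have partial: "ennreal (v N) * a N + (\<Sum>j<N. ennreal (w j) * a j)
      \<le> ennreal (2 powr (p - 1)) * (\<Sum>j<N. g j)" for N
  proof (induction N)
    case 0
    then show ?case by (simp add: assms)
  next
    case (Suc N)
    have "ennreal (v (Suc N)) * a (Suc N) + (\<Sum>j<Suc N. ennreal (w j) * a j)
      = (ennreal (v (Suc N)) * a (Suc N) + ennreal (w N) * a N) + (\<Sum>j<N. ennreal (w j) * a j)"
      by (simp add: algebra_simps)
    also have "\<dots> \<le> (ennreal (v N) * a N + ennreal (2 powr (p - 1)) * g N) + (\<Sum>j<N. ennreal (w j) * a j)"
      by (intro add_right_mono telescope)
    also have "\<dots> = (ennreal (v N) * a N + (\<Sum>j<N. ennreal (w j) * a j)) + ennreal (2 powr (p - 1)) * g N"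
      by (simp add: algebra_simps)
    also have "\<dots> \<le> ennreal (2 powr (p - 1)) * (\<Sum>j<N. g j) + ennreal (2 powr (p - 1)) * g N"
      by (intro add_right_mono Suc.IH)
    finally show ?case by (simp add: algebra_simps)
  qed
  have "ennreal c * (\<Sum>j. ennreal (real (Suc j) powr (- p)) * a j) = (\<Sum>j. ennreal (w j) * a j)"
    unfolding ennreal_suminf_cmult[symmetric] w_def using c by (simp add: ennreal_mult mult.assoc)
  also have "\<dots> \<le> ennreal (2 powr (p - 1)) * (\<Sum>j. g j)"
  proof (rule suminf_le_const)
    fix N
    have "(\<Sum>j<N. ennreal (w j) * a j) \<le> ennreal (v N) * a N + (\<Sum>j<N. ennreal (w j) * a j)"
      by simp
    also note partial
    also have "ennreal (2 powr (p - 1)) * (\<Sum>j<N. g j) \<le> ennreal (2 powr (p - 1)) * (\<Sum>j. g j)"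
      by (intro mult_left_mono sum_le_suminf) auto
    finally show "(\<Sum>j<N. ennreal (w j) * a j) \<le> ennreal (2 powr (p - 1)) * (\<Sum>j. g j)" .
  qed simp
  finally show ?thesis by (simp add: c_def)
qed

section \<open>Dyadic shells and their volume\<close>

text \<open>Half-open, so that the shells of radii R / 2^j partition the punctured open ball of
  radius \<open>R\<close>.\<close>

definition shell :: "real \<Rightarrow> 'a::real_normed_vector set" where
  "shell r = {x. r / 2 \<le> norm x \<and> norm x < r}"

lemma shell_borel [measurable]: "shell r \<in> sets borel"
  unfolding shell_def by measurable

lemma emeasure_shell:
  assumes "r > 0"
  shows "emeasure lborel (shell r :: 'a::euclidean_space set)
    = ennreal (unit_ball_vol DIM('a) * (1 - (1/2) ^ DIM('a)) * r ^ DIM('a))"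
proof -
  have "(shell r :: 'a set) = ball 0 r - ball 0 (r / 2)"
    by (auto simp: shell_def)
  also have "emeasure lborel \<dots> = emeasure lborel (ball (0::'a) r) - emeasure lborel (ball (0::'a) (r / 2))"
    using assms by (intro emeasure_Diff) (auto simp: emeasure_ball)
  also have "\<dots> = ennreal (unit_ball_vol DIM('a) * r ^ DIM('a) - unit_ball_vol DIM('a) * (r / 2) ^ DIM('a))"
    using assms by (simp add: emeasure_ball ennreal_minus)
  also have "unit_ball_vol DIM('a) * r ^ DIM('a) - unit_ball_vol DIM('a) * (r / 2) ^ DIM('a)
    = unit_ball_vol DIM('a) * (1 - (1/2) ^ DIM('a)) * r ^ DIM('a)"
    by (simp add: power_divide algebra_simps)
  finally show ?thesis .
qed

lemma emeasure_shell_Times_ball: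
  assumes "r > 0" "\<rho> > 0"
  shows "emeasure lborel ((shell r \<times> ball z \<rho>) :: ('a::euclidean_space \<times> 'b::euclidean_space) set)
    = ennreal (unit_ball_vol DIM('a) * (1 - (1/2) ^ DIM('a)) * r ^ DIM('a)
        * (unit_ball_vol DIM('b) * \<rho> ^ DIM('b)))"
proof -
  have "emeasure lborel ((shell r \<times> ball z \<rho>) :: ('a \<times> 'b) set) =
     emeasure (lborel \<Otimes>\<^sub>M lborel) ((shell r \<times> ball z \<rho>) :: ('a \<times> 'b) set)"
    by (simp add: lborel_prod)
  also have "\<dots> = emeasure lborel (shell r :: 'a set) * emeasure lborel (ball z \<rho>)"
    by (intro lborel.emeasure_pair_measure_Times) auto
  also have "\<dots> = ennreal (unit_ball_vol DIM('a) * (1 - (1/2) ^ DIM('a)) * r ^ DIM('a)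
        * (unit_ball_vol DIM('b) * \<rho> ^ DIM('b)))"
    using assms by (simp add: emeasure_shell emeasure_ball power_le_one flip: ennreal_mult)
  finally show ?thesis .
qed


section \<open>The kernel and the coupling of consecutive shells\<close>

text \<open>The exponent \<open>q\<close> will be d + sp. On the diagonal the quotient is 0 / 0 =
  0.\<close>

definition weighted_kernel ::
  "real \<Rightarrow> real \<Rightarrow> real \<Rightarrow> real \<Rightarrow> ('a::real_normed_vector \<times> 'b::real_normed_vector \<Rightarrow> real)
    \<Rightarrow> 'a \<times> 'b \<Rightarrow> 'a \<times> 'b \<Rightarrow> real" where
  "weighted_kernel p q \<alpha> \<beta> u x y =
    \<bar>u x - u y\<bar> powr p / norm (x - y) powr q * norm (fst x) powr \<alpha> * norm (fst y) powr \<beta>"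

text \<open>No condition links \<open>fst x\<close> to \<open>fst y\<close> beyond their shells.
  Hence every nonempty slice, in either variable, is a shell times a ball of radius
  \<open>r\<close>, and its measure does not depend on the fixed point.\<close>

definition near_shells :: "real \<Rightarrow> (('a::real_normed_vector \<times> 'b::real_normed_vector) \<times> ('a \<times> 'b)) set" where
  "near_shells r = {(x, y). fst x \<in> shell r \<and> fst y \<in> shell (r / 2) \<and> dist (snd x) (snd y) < r}"

text \<open>On coupled pairs |x - y| is at most 3r, and the two block norms are at least r/2 and r/4
  and at most r. So the kernel factor is bounded below by a multiple of r^(alpha + beta - q) =
  r^(-n).\<close>

lemma abs_diff_powr_le_weighted_kernel:
  fixes u :: "'a::euclidean_space \<times> 'b::euclidean_space \<Rightarrow> real"
  assumes "r > 0" "q \<ge> 0" "(x, y) \<in> near_shells r" "q = real n + \<alpha> + \<beta>"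
  shows "\<bar>u x - u y\<bar> powr p
    \<le> 3 powr q * 2 powr \<bar>\<alpha>\<bar> * 4 powr \<bar>\<beta>\<bar> * r ^ n * weighted_kernel p q \<alpha> \<beta> u x y"
proof -
  have x: "r / 2 \<le> norm (fst x)" "norm (fst x) < r"
    and y: "r / 4 \<le> norm (fst y)" "norm (fst y) < r / 2"
    and d: "dist (snd x) (snd y) < r"
    using assms(3) by (auto simp: near_shells_def shell_def)
  \<comment> \<open>The two shells are disjoint, so the division by |x - y|^q is by a positive
    number.\<close>
  have "x \<noteq> y" using x y by auto
  then have pos: "norm (x - y) > 0" by simp
  have "norm (x - y) \<le> norm (fst x - fst y) + norm (snd x - snd y)"
    using norm_Pair_le[of "fst x - fst y" "snd x - snd y"] by (simp add: minus_prod_def)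
  also have "\<dots> \<le> norm (fst x) + norm (fst y) + dist (snd x) (snd y)"
    using norm_triangle_ineq4[of "fst x" "fst y"] by (simp add: dist_norm)
  also have "\<dots> \<le> 3 * r" using x y d \<open>r > 0\<close> by linarith
  finally have "norm (x - y) powr q \<le> (3 * r) powr q"
    using assms(2) by (intro powr_mono2) auto
  then have N: "norm (x - y) powr q \<le> 3 powr q * r powr q"
    using assms(1) by (simp add: powr_mult)
  have A: "(1/2) powr \<bar>\<alpha>\<bar> * r powr \<alpha> \<le> norm (fst x) powr \<alpha>"
    using assms(1) x by (intro powr_ge_of_ratio_bounds) auto
  have B: "(1/4) powr \<bar>\<beta>\<bar> * r powr \<beta> \<le> norm (fst y) powr \<beta>"
    using assms(1) y by (intro powr_ge_of_ratio_bounds) auto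
  \<comment> \<open>The factors (1/2)^|alpha| and (1/4)^|beta| cancel against the constants in
    front, and the powers of \<open>r\<close> add up to r^q.\<close>
  have "norm (x - y) powr q
      \<le> 3 powr q * 2 powr \<bar>\<alpha>\<bar> * 4 powr \<bar>\<beta>\<bar> * r ^ n
        * (((1/2) powr \<bar>\<alpha>\<bar> * r powr \<alpha>) * ((1/4) powr \<bar>\<beta>\<bar> * r powr \<beta>))"
    using N assms(1) unfolding assms(4)
    by (simp add: powr_add powr_realpow powr_divide mult_ac)
  also have "\<dots> \<le> 3 powr q * 2 powr \<bar>\<alpha>\<bar> * 4 powr \<bar>\<beta>\<bar> * r ^ n
        * (norm (fst x) powr \<alpha> * norm (fst y) powr \<beta>)"
    using assms(1) by (intro mult_left_mono mult_mono A B) auto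
  finally have *: "norm (x - y) powr q \<le> \<dots>" .
  have "\<bar>u x - u y\<bar> powr p = \<bar>u x - u y\<bar> powr p / norm (x - y) powr q * norm (x - y) powr q"
    using pos by simp
  also have "\<dots> \<le> \<bar>u x - u y\<bar> powr p / norm (x - y) powr q
      * (3 powr q * 2 powr \<bar>\<alpha>\<bar> * 4 powr \<bar>\<beta>\<bar> * r ^ n * (norm (fst x) powr \<alpha> * norm (fst y) powr \<beta>))"
    by (intro mult_left_mono *) auto
  finally show ?thesis by (simp add: weighted_kernel_def mult_ac)
qed

lemma near_shells_borel [measurable]:
  "near_shells r \<in> sets (borel \<Otimes>\<^sub>M borel :: (('a::euclidean_space \<times> 'b::euclidean_space) \<times> ('a \<times> 'b)) measure)"
proof -
  have [measurable]: "fst \<in> borel \<rightarrow>\<^sub>M (borel :: 'a measure)" "snd \<in> borel \<rightarrow>\<^sub>M (borel :: 'b measure)"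
    by (simp_all add: borel_measurable_continuous_onI continuous_on_fst continuous_on_snd)
  have "near_shells r = {z \<in> space (borel \<Otimes>\<^sub>M borel :: (('a \<times> 'b) \<times> ('a \<times> 'b)) measure).
      fst (fst z) \<in> shell r \<and> fst (snd z) \<in> shell (r / 2) \<and> dist (snd (fst z)) (snd (snd z)) < r}"
    by (auto simp: near_shells_def space_pair_measure)
  also have "\<dots> \<in> sets (borel \<Otimes>\<^sub>M borel)" by measurable
  finally show ?thesis .
qed

lemma weighted_kernel_measurable [measurable]:
  fixes u :: "'a::euclidean_space \<times> 'b::euclidean_space \<Rightarrow> real"
  assumes [measurable]: "u \<in> borel_measurable borel"
  shows "(\<lambda>(x, y). weighted_kernel p q \<alpha> \<beta> u x y) \<in> borel_measurable (borel \<Otimes>\<^sub>M borel)"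
proof -
  have [measurable]: "fst \<in> borel \<rightarrow>\<^sub>M (borel :: 'a measure)" "snd \<in> borel \<rightarrow>\<^sub>M (borel :: 'b measure)"
    by (simp_all add: borel_measurable_continuous_onI continuous_on_fst continuous_on_snd)
  show ?thesis
    unfolding weighted_kernel_def by measurable
qed

section \<open>Comparison of consecutive shells\<close>

text \<open>Up to a fixed constant, an average over the first block and a full integral over the
  second. The power of \<open>r\<close> imitates the weight |x_k|^(-k).\<close>

definition shell_mean :: "real \<Rightarrow> ('a::euclidean_space \<times> 'b::euclidean_space \<Rightarrow> real) \<Rightarrow> real \<Rightarrow> ennreal" where
  "shell_mean p u r = ennreal (1 / r ^ DIM('a)) *
    (\<integral>\<^sup>+x. indicator (shell r \<times> UNIV) x * ennreal (\<bar>u x\<bar> powr p) \<partial>lborel)"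

definition shell_energy ::
  "real \<Rightarrow> real \<Rightarrow> real \<Rightarrow> real \<Rightarrow> ('a::euclidean_space \<times> 'b::euclidean_space \<Rightarrow> real) \<Rightarrow> real \<Rightarrow> ennreal" where
  "shell_energy p q \<alpha> \<beta> u r =
    (\<integral>\<^sup>+y. (\<integral>\<^sup>+x. indicator (near_shells r) (x, y) * ennreal (weighted_kernel p q \<alpha> \<beta> u x y) \<partial>lborel) \<partial>lborel)"

lemma shell_Times_UNIV_borel [measurable]:
  "(shell r \<times> UNIV :: ('a::euclidean_space \<times> 'b::euclidean_space) set) \<in> sets borel"
  by (intro borel_Times) auto

text \<open>Tonelli brings the integral over \<open>y\<close> inside. The slice over
  \<open>x\<close> has constant measure on the shell, so the marginal of the coupling is a multiple
  of Lebesgue measure there.\<close>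

lemma nn_integral_near_shells_fst:
  fixes f :: "'a::euclidean_space \<times> 'b::euclidean_space \<Rightarrow> ennreal"
  assumes "r > 0" and [measurable]: "f \<in> borel_measurable borel"
  shows "(\<integral>\<^sup>+y. (\<integral>\<^sup>+x. indicator (near_shells r) (x, y) * f x \<partial>lborel) \<partial>lborel)
    = ennreal (unit_ball_vol DIM('a) * (1 - (1/2) ^ DIM('a)) * (r / 2) ^ DIM('a)
        * (unit_ball_vol DIM('b) * r ^ DIM('b)))
      * (\<integral>\<^sup>+x. indicator (shell r \<times> UNIV) x * f x \<partial>lborel)" (is "?L = ennreal ?c * _")
proof -
  have slice: "(\<integral>\<^sup>+y. indicator (near_shells r) (x, y) * f x \<partial>lborel)
      = ennreal ?c * (indicator (shell r \<times> UNIV) x * f x)" for x :: "'a \<times> 'b"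
  proof -
    have "(\<integral>\<^sup>+y. indicator (near_shells r) (x, y) * f x \<partial>lborel)
      = (\<integral>\<^sup>+(y :: 'a \<times> 'b). (indicator (shell r \<times> UNIV) x * f x) * indicator (shell (r / 2) \<times> ball (snd x) r) y \<partial>lborel)"
      by (intro nn_integral_cong) (auto simp: near_shells_def indicator_def mem_Times_iff split: prod.splits)
    also have "\<dots> = (indicator (shell r \<times> UNIV) x * f x) * emeasure lborel (shell (r / 2) \<times> ball (snd x) r :: ('a \<times> 'b) set)"
      by (intro nn_integral_cmult_indicator) (simp add: borel_Times)
    finally show ?thesis
      using assms(1) by (simp add: emeasure_shell_Times_ball mult_ac)
  qed
  have "?L = (\<integral>\<^sup>+x. (\<integral>\<^sup>+y. indicator (near_shells r) (x, y) * f x \<partial>lborel) \<partial>lborel)"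
    by (intro lborel_pair.Fubini') measurable
  also have "\<dots> = ennreal ?c * (\<integral>\<^sup>+x. indicator (shell r \<times> UNIV) x * f x \<partial>lborel)"
    unfolding slice by (intro nn_integral_cmult) measurable
  finally show ?thesis .
qed

text \<open>The other marginal, with \<open>x\<close> already the inner variable. Its constant is
  2^k times the previous one, which is the ratio of the normalisations of \<open>shell_mean\<close>
  at \<open>r / 2\<close> and at \<open>r\<close>.\<close>

lemma nn_integral_near_shells_snd:
  fixes f :: "'a::euclidean_space \<times> 'b::euclidean_space \<Rightarrow> ennreal"
  assumes "r > 0" and [measurable]: "f \<in> borel_measurable borel"
  shows "(\<integral>\<^sup>+y. (\<integral>\<^sup>+x. indicator (near_shells r) (x, y) * f y \<partial>lborel) \<partial>lborel)
    = ennreal (unit_ball_vol DIM('a) * (1 - (1/2) ^ DIM('a)) * r ^ DIM('a)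
        * (unit_ball_vol DIM('b) * r ^ DIM('b)))
      * (\<integral>\<^sup>+y. indicator (shell (r / 2) \<times> UNIV) y * f y \<partial>lborel)" (is "?L = ennreal ?c * _")
proof -
  have slice: "(\<integral>\<^sup>+x. indicator (near_shells r) (x, y) * f y \<partial>lborel)
      = ennreal ?c * (indicator (shell (r / 2) \<times> UNIV) y * f y)" for y :: "'a \<times> 'b"
  proof -
    have "(\<integral>\<^sup>+x. indicator (near_shells r) (x, y) * f y \<partial>lborel)
      = (\<integral>\<^sup>+(x :: 'a \<times> 'b). (indicator (shell (r / 2) \<times> UNIV) y * f y) * indicator (shell r \<times> ball (snd y) r) x \<partial>lborel)"
      by (intro nn_integral_cong)
        (auto simp: near_shells_def indicator_def dist_commute mem_Times_iff split: prod.splits)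
    also have "\<dots> = (indicator (shell (r / 2) \<times> UNIV) y * f y) * emeasure lborel (shell r \<times> ball (snd y) r :: ('a \<times> 'b) set)"
      by (intro nn_integral_cmult_indicator) (simp add: borel_Times)
    finally show ?thesis
      using assms(1) by (simp add: emeasure_shell_Times_ball mult_ac)
  qed
  show ?thesis
    unfolding slice by (intro nn_integral_cmult) measurable
qed


lemma weighted_kernel_nonneg: "weighted_kernel p q \<alpha> \<beta> u x y \<ge> 0"
  by (simp add: weighted_kernel_def)

text \<open>Integrate the split of |u(y)|^p over the coupled pairs. Since both marginals are exact,
  \<open>shell_mean p u r\<close> keeps the factor (1-t)^(1-p) with no further constant, as the
  telescoping requires. \<open>K\<close> depends on neither \<open>r\<close> nor
  \<open>t\<close>.\<close>

lemma shell_mean_half_le: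
  fixes u :: "'a::euclidean_space \<times> 'b::euclidean_space \<Rightarrow> real"
  assumes [measurable]: "u \<in> borel_measurable borel"
    and "p \<ge> 1" "0 < t" "t < 1" "r > 0" "q \<ge> 0"
    and q: "q = real (DIM('a) + DIM('b) + DIM('a)) + \<alpha> + \<beta>"
  defines "K \<equiv> 3 powr q * 2 powr \<bar>\<alpha>\<bar> * 4 powr \<bar>\<beta>\<bar> * 2 ^ DIM('a)
    / (unit_ball_vol DIM('a) * (1 - (1/2) ^ DIM('a)) * unit_ball_vol DIM('b))"
  shows "shell_mean p u (r / 2) \<le> ennreal ((1 - t) powr (1 - p)) * shell_mean p u r
    + ennreal (t powr (1 - p)) * (ennreal K * shell_energy p q \<alpha> \<beta> u r)"
proof -
  define n where "n = DIM('a) + DIM('b) + DIM('a)"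
  define C where "C = 3 powr q * 2 powr \<bar>\<alpha>\<bar> * 4 powr \<bar>\<beta>\<bar>"
  define V where "V = unit_ball_vol DIM('a) * (1 - (1/2) ^ DIM('a))"
  define B where "B = unit_ball_vol DIM('b)"
  define c1 where "c1 = (1 - t) powr (1 - p)"
  define c2 where "c2 = t powr (1 - p)"
  define f where "f x = ennreal (\<bar>u x\<bar> powr p)" for x
  define I where "I \<rho> = (\<integral>\<^sup>+x. indicator (shell \<rho> \<times> UNIV) x * f x \<partial>lborel)" for \<rho>
  define E where "E = shell_energy p q \<alpha> \<beta> u r"
  have "(1/2) ^ DIM('a) < (1::real)"
    by (intro power_less_one_iff[THEN iffD2]) auto
  then have V: "V > 0" by (simp add: V_def)
  have B: "B > 0" by (simp add: B_def)
  have C: "C \<ge> 0" by (simp add: C_def)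
  have c: "c1 \<ge> 0" "c2 \<ge> 0" by (simp_all add: c1_def c2_def)
  have [measurable]: "f \<in> borel_measurable borel" unfolding f_def by measurable
  have K: "C * 2 ^ DIM('a) / (V * B) = K" by (simp add: K_def C_def V_def B_def)
  have "ennreal (V * r ^ DIM('a) * (B * r ^ DIM('b))) * I (r / 2)
      = (\<integral>\<^sup>+y. (\<integral>\<^sup>+x. indicator (near_shells r) (x, y) * f y \<partial>lborel) \<partial>lborel)"
    unfolding V_def B_def I_def using assms by (subst nn_integral_near_shells_snd) auto
  also have "\<dots> \<le> (\<integral>\<^sup>+y. (\<integral>\<^sup>+x. ennreal c1 * (indicator (near_shells r) (x, y) * f x)
      + ennreal (c2 * C * r ^ n) * (indicator (near_shells r) (x, y) * ennreal (weighted_kernel p q \<alpha> \<beta> u x y)) \<partial>lborel) \<partial>lborel)"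
  proof (intro nn_integral_mono)
    fix x y :: "'a \<times> 'b"
    show "indicator (near_shells r) (x, y) * f y \<le> ennreal c1 * (indicator (near_shells r) (x, y) * f x)
      + ennreal (c2 * C * r ^ n) * (indicator (near_shells r) (x, y) * ennreal (weighted_kernel p q \<alpha> \<beta> u x y))"
    proof (cases "(x, y) \<in> near_shells r")
      case True
      have "\<bar>u y\<bar> powr p \<le> c1 * \<bar>u x\<bar> powr p + c2 * \<bar>u x - u y\<bar> powr p"
        unfolding c1_def c2_def using assms by (intro abs_powr_split_le)
      also have "\<dots> \<le> c1 * \<bar>u x\<bar> powr p + c2 * (C * r ^ n * weighted_kernel p q \<alpha> \<beta> u x y)"
        unfolding C_def
        using abs_diff_powr_le_weighted_kernel[OF assms(5,6) True q] c
        by (intro add_left_mono mult_left_mono) (auto simp: n_def)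
      finally have "ennreal (\<bar>u y\<bar> powr p)
          \<le> ennreal (c1 * \<bar>u x\<bar> powr p + c2 * (C * r ^ n * weighted_kernel p q \<alpha> \<beta> u x y))"
        by (rule ennreal_leI)
      also have "\<dots> = ennreal c1 * f x + ennreal (c2 * C * r ^ n) * ennreal (weighted_kernel p q \<alpha> \<beta> u x y)"
        using c C assms(5) weighted_kernel_nonneg[of p q \<alpha> \<beta> u x y]
        by (simp add: f_def mult.assoc flip: ennreal_mult)
      finally show ?thesis using True by (simp add: f_def)
    qed simp
  qed
  also have "\<dots> = ennreal c1 * (\<integral>\<^sup>+y. (\<integral>\<^sup>+x. indicator (near_shells r) (x, y) * f x \<partial>lborel) \<partial>lborel)
      + ennreal (c2 * C * r ^ n) * E"
    unfolding E_def shell_energy_def by (simp add: nn_integral_add nn_integral_cmult)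
  also have "\<dots> = ennreal c1 * (ennreal (V * (r / 2) ^ DIM('a) * (B * r ^ DIM('b))) * I r)
      + ennreal (c2 * C * r ^ n) * E"
    unfolding V_def B_def I_def using assms by (subst nn_integral_near_shells_fst) auto
  finally have ineq: "ennreal (V * r ^ DIM('a) * (B * r ^ DIM('b))) * I (r / 2) \<le> \<dots>" .
  \<comment> \<open>Chosen to turn the left side into the mean at \<open>r / 2\<close>. It also
    turns the first term on the right into the mean at \<open>r\<close>, and it cancels r^n up to
    2^k because \<open>n\<close> counts the first block twice.\<close>
  define \<kappa> where "\<kappa> = 1 / (V * r ^ DIM('a) * (B * r ^ DIM('b)) * (r / 2) ^ DIM('a))"
  have \<kappa>: "\<kappa> \<ge> 0" using V B assms(5) by (simp add: \<kappa>_def)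
  have "shell_mean p u (r / 2)
      = ennreal (\<kappa> * (V * r ^ DIM('a) * (B * r ^ DIM('b)))) * I (r / 2)"
    using V B assms(5) by (simp add: shell_mean_def I_def f_def \<kappa>_def)
  also have "\<dots> = ennreal \<kappa> * (ennreal (V * r ^ DIM('a) * (B * r ^ DIM('b))) * I (r / 2))"
    using \<kappa> V B assms(5) by (simp add: ennreal_mult mult.assoc)
  also have "\<dots> \<le> ennreal \<kappa> * (ennreal c1 * (ennreal (V * (r / 2) ^ DIM('a) * (B * r ^ DIM('b))) * I r)
      + ennreal (c2 * C * r ^ n) * E)"
    by (intro mult_left_mono ineq) auto
  also have "\<dots> = ennreal c1 * (ennreal (\<kappa> * (V * (r / 2) ^ DIM('a) * (B * r ^ DIM('b)))) * I r)
      + ennreal c2 * (ennreal (\<kappa> * (C * r ^ n)) * E)"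
    using \<kappa> V B c C assms(5) by (simp add: ennreal_mult algebra_simps)
  also have "\<kappa> * (V * (r / 2) ^ DIM('a) * (B * r ^ DIM('b))) = 1 / r ^ DIM('a)"
    using V B assms(5) by (simp add: \<kappa>_def)
  also have "\<kappa> * (C * r ^ n) = K"
    unfolding K[symmetric] using V B assms(5)
    by (simp add: \<kappa>_def n_def power_add power_divide)
  finally show ?thesis
    by (simp add: shell_mean_def I_def f_def c1_def c2_def E_def)
qed

section \<open>Summation over all shells\<close>

lemma shell_mem_unique:
  assumes "R > 0" "x \<in> shell (R / 2 ^ i)" "x \<in> shell (R / 2 ^ j)"
  shows "i = j"
proof -
  have *: False if "i < j" "x \<in> shell (R / 2 ^ i)" "x \<in> shell (R / 2 ^ j)" for i j
  proof -
    have "(2::real) ^ Suc i \<le> 2 ^ j" using that(1) by (intro power_increasing) auto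
    then have "R / 2 ^ j \<le> R / 2 ^ Suc i" using assms(1) by (intro divide_left_mono) auto
    then show False using that(2,3) by (auto simp: shell_def)
  qed
  show ?thesis using *[of i j] *[of j i] assms by (cases i j rule: linorder_cases) auto
qed

lemma ex_shell_mem:
  assumes "x \<noteq> 0" "norm x < R"
  shows "\<exists>j. x \<in> shell (R / 2 ^ j)"
proof -
  have x: "norm x > 0" using assms by simp
  obtain N where "R / norm x < 2 ^ N" using real_arch_pow[of 2 "R / norm x"] by auto
  then have "R / 2 ^ N \<le> norm x" using x by (simp add: field_simps)
  then obtain j where "\<not> R / 2 ^ j \<le> norm x" "R / 2 ^ Suc j \<le> norm x"
    using exists_least_lemma[of "\<lambda>j. R / 2 ^ j \<le> norm x"] assms(2) by auto
  then show ?thesis by (auto simp: shell_def intro!: exI[of _ j])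
qed

text \<open>\<open>fst x\<close> lies in at most one shell, so the sets of coupled pairs are
  disjoint and no part of the double integral is counted twice.\<close>

lemma sum_shell_energy_le:
  fixes u :: "'a::euclidean_space \<times> 'b::euclidean_space \<Rightarrow> real"
  assumes [measurable]: "u \<in> borel_measurable borel" and "R > 0"
  shows "(\<Sum>j. shell_energy p q \<alpha> \<beta> u (R / 2 ^ j))
    \<le> (\<integral>\<^sup>+y. (\<integral>\<^sup>+x. ennreal (weighted_kernel p q \<alpha> \<beta> u x y) \<partial>lborel) \<partial>lborel)"
proof -
  have disj: "disjoint_family (\<lambda>j. near_shells (R / 2 ^ j) :: (('a \<times> 'b) \<times> ('a \<times> 'b)) set)"
    unfolding disjoint_family_on_def near_shells_def using shell_mem_unique[OF assms(2)] by blast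
  have "(\<Sum>j. shell_energy p q \<alpha> \<beta> u (R / 2 ^ j)) = (\<integral>\<^sup>+y. (\<integral>\<^sup>+x. (\<Sum>j. indicator (near_shells (R / 2 ^ j)) (x, y)
      * ennreal (weighted_kernel p q \<alpha> \<beta> u x y)) \<partial>lborel) \<partial>lborel)"
    unfolding shell_energy_def by (simp add: nn_integral_suminf del: ennreal_suminf_multc)
  also have "\<dots> \<le> (\<integral>\<^sup>+y. (\<integral>\<^sup>+x. ennreal (weighted_kernel p q \<alpha> \<beta> u x y) \<partial>lborel) \<partial>lborel)"
    by (intro nn_integral_mono) (auto simp: suminf_indicator[OF disj] split: split_indicator)
  finally show ?thesis .
qed

text \<open>The shells of radii 2R / 2^j cover all points where \<open>u\<close> is nonzero. The
  factor 2^k comes from |x_k| >= r_j / 2, and (ln 2)^(-p) from the bound on the logarithm.\<close>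

lemma nn_integral_log_weight_le:
  fixes u :: "'a::euclidean_space \<times> 'b::euclidean_space \<Rightarrow> real"
  assumes [measurable]: "u \<in> borel_measurable borel" and "R > 0" "p > 0"
    and supp: "\<And>x. u x \<noteq> 0 \<Longrightarrow> fst x \<noteq> 0 \<and> norm (fst x) < R"
  shows "(\<integral>\<^sup>+x. ennreal (\<bar>u x\<bar> powr p / (norm (fst x) ^ DIM('a) * ln (4 * R / norm (fst x)) powr p)) \<partial>lborel)
    \<le> ennreal (2 ^ DIM('a) * ln 2 powr (- p))
      * (\<Sum>j. ennreal (real (Suc j) powr (- p)) * shell_mean p u (2 * R / 2 ^ j))"
proof -
  define k where "k = DIM('a)"
  define L :: real where "L = 2 ^ k * ln 2 powr (- p)"
  define r where "r j = 2 * R / 2 ^ j" for j :: nat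
  define T where "T j x = ennreal L * (ennreal (real (Suc j) powr (- p)) * (ennreal (1 / r j ^ k)
    * (indicator (shell (r j) \<times> UNIV) x * ennreal (\<bar>u x\<bar> powr p))))" for j x
  have r: "r j > 0" for j using assms by (simp add: r_def)
  have pointwise: "ennreal (\<bar>u x\<bar> powr p / (norm (fst x) ^ k * ln (4 * R / norm (fst x)) powr p)) \<le> (\<Sum>j. T j x)" for x
  proof (cases "u x = 0")
    case False
    define \<xi> where "\<xi> = norm (fst x)"
    have \<xi>: "0 < \<xi>" "\<xi> < R" using supp[OF False] by (auto simp: \<xi>_def)
    obtain j where j: "fst x \<in> shell (r j)"
      unfolding r_def using ex_shell_mem[of "fst x" "2 * R"] supp[OF False] assms by auto
    then have rj: "r j / 2 \<le> \<xi>" "\<xi> < r j" by (auto simp: shell_def \<xi>_def)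
    \<comment> \<open>The 4 in the logarithm against the starting radius 2R gives the exponent j +
      1, so the lower bound is positive already for j = 0.\<close>
    have "2 ^ Suc j = 4 * R / r j" using assms by (simp add: r_def)
    also have "\<dots> \<le> 4 * R / \<xi>" using rj \<xi> assms by (intro divide_left_mono) auto
    finally have "ln (2 ^ Suc j) \<le> ln (4 * R / \<xi>)"
      using \<xi> assms by (intro ln_mono) auto
    then have "real (Suc j) * ln 2 \<le> ln (4 * R / \<xi>)"
      by (simp add: ln_realpow del: power_Suc)
    then have "(real (Suc j) * ln 2) powr p \<le> ln (4 * R / \<xi>) powr p"
      using assms by (intro powr_mono2) auto
    moreover have "(r j / 2) ^ k \<le> \<xi> ^ k"
      using rj r[of j] by (intro power_mono) auto
    ultimately have "(r j / 2) ^ k * (real (Suc j) * ln 2) powr p \<le> \<xi> ^ k * ln (4 * R / \<xi>) powr p"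
      using r[of j] \<xi> by (intro mult_mono) auto
    moreover have "0 < (r j / 2) ^ k * (real (Suc j) * ln 2) powr p"
      using r[of j] by (intro mult_pos_pos) auto
    ultimately have "\<bar>u x\<bar> powr p / (\<xi> ^ k * ln (4 * R / \<xi>) powr p)
        \<le> \<bar>u x\<bar> powr p / ((r j / 2) ^ k * (real (Suc j) * ln 2) powr p)"
      by (intro frac_le) simp_all
    also have "\<dots> = L * (real (Suc j) powr (- p) * (1 / r j ^ k * \<bar>u x\<bar> powr p))"
      unfolding powr_mult
      using r[of j] by (simp add: L_def powr_minus field_simps power_divide del: of_nat_Suc)
    finally have "ennreal (\<bar>u x\<bar> powr p / (\<xi> ^ k * ln (4 * R / \<xi>) powr p)) \<le> T j x"
      using j r[of j] by (simp add: T_def L_def mem_Times_iff ennreal_leI flip: ennreal_mult)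
    also have "\<dots> \<le> (\<Sum>j. T j x)"
      using sum_le_suminf[of "\<lambda>j. T j x" "{j}"] by simp
    finally show ?thesis by (simp add: \<xi>_def)
  qed simp
  have "(\<integral>\<^sup>+x. ennreal (\<bar>u x\<bar> powr p / (norm (fst x) ^ k * ln (4 * R / norm (fst x)) powr p)) \<partial>lborel)
    \<le> (\<integral>\<^sup>+x. (\<Sum>j. T j x) \<partial>lborel)"
    by (intro nn_integral_mono pointwise)
  also have "\<dots> = (\<Sum>j. \<integral>\<^sup>+x. T j x \<partial>lborel)"
    unfolding T_def by (intro nn_integral_suminf) measurable
  also have "\<dots> = ennreal L * (\<Sum>j. ennreal (real (Suc j) powr (- p)) * shell_mean p u (r j))"
    unfolding T_def shell_mean_def k_def by (simp add: nn_integral_cmult)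
  finally show ?thesis by (simp add: L_def k_def r_def)
qed

section \<open>The inequality for Borel functions on a product space\<close>

lemma fractional_log_hardy:
  assumes "p > 1" "q \<ge> 0"
    and q: "q = real (DIM('a::euclidean_space) + DIM('b::euclidean_space) + DIM('a)) + \<alpha> + \<beta>"
  shows "\<exists>C>0. \<forall>R>0. \<forall>u :: 'a \<times> 'b \<Rightarrow> real. u \<in> borel_measurable borel \<longrightarrow>
    (\<forall>x. u x \<noteq> 0 \<longrightarrow> fst x \<noteq> 0 \<and> norm (fst x) < R) \<longrightarrow>
    (\<integral>\<^sup>+x. ennreal (\<bar>u x\<bar> powr p / (norm (fst x) ^ DIM('a) * ln (4 * R / norm (fst x)) powr p)) \<partial>lborel)
    \<le> ennreal C * (\<integral>\<^sup>+y. (\<integral>\<^sup>+x. ennreal (weighted_kernel p q \<alpha> \<beta> u x y) \<partial>lborel) \<partial>lborel)"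
proof -
  define K where "K = 3 powr q * 2 powr \<bar>\<alpha>\<bar> * 4 powr \<bar>\<beta>\<bar> * 2 ^ DIM('a)
    / (unit_ball_vol DIM('a) * (1 - (1/2) ^ DIM('a)) * unit_ball_vol DIM('b))"
  define L :: real where "L = 2 ^ DIM('a) * ln 2 powr (- p)"
  define c where "c = (p - 1) / 2 * (3/2) powr (- p)"
  have "(1/2) ^ DIM('a) < (1::real)"
    by (intro power_less_one_iff[THEN iffD2]) auto
  then have K: "K > 0" by (simp add: K_def)
  have L: "L > 0" by (simp add: L_def)
  have c: "c > 0" using assms by (simp add: c_def)
  show ?thesis
  \<comment> \<open>\<open>L\<close> is the loss from the logarithmic weight, 1/c undoes the
    constant of the discrete inequality, and 2^(p-1) times \<open>K\<close> is the coefficient of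
    the energies. All are fixed before \<open>R\<close> and \<open>u\<close>.\<close>
  proof (intro exI[of _ "L * (1 / c) * 2 powr (p - 1) * K"] conjI allI impI)
    show "L * (1 / c) * 2 powr (p - 1) * K > 0" using K L c by simp
  next
    fix R :: real and u :: "'a \<times> 'b \<Rightarrow> real"
    assume R: "R > 0" and [measurable]: "u \<in> borel_measurable borel"
      and supp: "\<forall>x. u x \<noteq> 0 \<longrightarrow> fst x \<noteq> 0 \<and> norm (fst x) < R"
    define a where "a j = shell_mean p u (2 * R / 2 ^ j)" for j :: nat
    define g where "g j = ennreal K * shell_energy p q \<alpha> \<beta> u (2 * R / 2 ^ j)" for j :: nat
    define S where "S = (\<Sum>j. ennreal (real (Suc j) powr (- p)) * a j)"
    define W where "W = (\<integral>\<^sup>+y. (\<integral>\<^sup>+x. ennreal (weighted_kernel p q \<alpha> \<beta> u x y) \<partial>lborel) \<partial>lborel)"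
    \<comment> \<open>This is why the radii start at 2R: on the outermost shell R <= |x_k| < 2R the
      function vanishes, which gives \<open>a 0 = 0\<close>.\<close>
    have zero: "indicator (shell (2 * R) \<times> UNIV) x * ennreal (\<bar>u x\<bar> powr p) = 0" for x
      using supp[rule_format, of x]
      by (cases "u x = 0") (auto simp: indicator_def mem_Times_iff shell_def)
    have "a 0 = 0" by (simp only: a_def shell_mean_def power_0 div_by_1 zero) simp
    moreover have "a (Suc j) \<le> ennreal ((1 - t) powr (1 - p)) * a j + ennreal (t powr (1 - p)) * g j"
      if "0 < t" "t < 1" for j t
      using shell_mean_half_le[of u p t "2 * R / 2 ^ j" q \<alpha> \<beta>] that assms R
      by (simp add: a_def g_def K_def mult.commute)
    ultimately have "ennreal c * S \<le> ennreal (2 powr (p - 1)) * (\<Sum>j. g j)"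
      unfolding c_def S_def by (intro discrete_log_hardy assms)
    also have "(\<Sum>j. g j) = ennreal K * (\<Sum>j. shell_energy p q \<alpha> \<beta> u (2 * R / 2 ^ j))"
      by (simp add: g_def)
    also have "ennreal (2 powr (p - 1)) * \<dots> \<le> ennreal (2 powr (p - 1)) * (ennreal K * W)"
      unfolding W_def using R by (intro mult_left_mono sum_shell_energy_le) auto
    finally have cS: "ennreal c * S \<le> \<dots>" .
    have "(\<integral>\<^sup>+x. ennreal (\<bar>u x\<bar> powr p / (norm (fst x) ^ DIM('a) * ln (4 * R / norm (fst x)) powr p)) \<partial>lborel)
        \<le> ennreal L * S"
      unfolding L_def S_def a_def using R assms(1) supp by (intro nn_integral_log_weight_le) auto
    also have "\<dots> = ennreal (L * (1 / c)) * (ennreal c * S)"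
      using c L by (simp add: mult.assoc[symmetric] flip: ennreal_mult)
    also have "\<dots> \<le> ennreal (L * (1 / c)) * (ennreal (2 powr (p - 1)) * (ennreal K * W))"
      by (intro mult_left_mono cS) auto
    also have "\<dots> = ennreal (L * (1 / c) * 2 powr (p - 1) * K) * W"
      using c L K by (simp add: mult.assoc[symmetric] flip: ennreal_mult)
    finally show "(\<integral>\<^sup>+x. ennreal (\<bar>u x\<bar> powr p / (norm (fst x) ^ DIM('a) * ln (4 * R / norm (fst x)) powr p)) \<partial>lborel)
        \<le> ennreal (L * (1 / c) * 2 powr (p - 1) * K)
          * (\<integral>\<^sup>+y. (\<integral>\<^sup>+x. ennreal (weighted_kernel p q \<alpha> \<beta> u x y) \<partial>lborel) \<partial>lborel)"
      unfolding W_def .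
  qed
qed

section \<open>Passage to the stated function class\<close>

text \<open>Differentiability gives continuity on the open set \<open>S\<close>, and off
  \<open>S\<close> the function is 0 because its support lies in \<open>S\<close>; the two pieces
  are glued.\<close>

lemma C1c_borel_measurable:
  assumes "u \<in> C1c S" "open S"
  shows "u \<in> borel_measurable borel"
proof -
  have cont: "continuous_on S u"
    using assms(1) has_derivative_continuous
    by (fastforce simp: C1c_def C1_on_def intro!: continuous_at_imp_continuous_on)
  have "u x = 0" if "x \<notin> S" for x
    using that assms(1) closure_subset[of "{x. u x \<noteq> 0}"] by (auto simp: C1c_def supp_def)
  then have "u = (\<lambda>x. if x \<in> S then u x else 0)" by auto
  also have "\<dots> \<in> borel_measurable borel"
    using assms(2) cont by (intro borel_measurable_continuous_on_if) auto
  finally show ?thesis .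
qed

theorem theorem2:
  fixes d k :: nat and p s \<alpha> \<beta> :: real
  assumes "d \<ge> 3" and "p > 1" and "0 < s" and "s < 1" and "1 < k" and "k < d"
    and "CARD('k::finite) = k" and "CARD('m::finite) = d - k"
    and "s * p = real k + \<alpha> + \<beta>"
  shows "\<exists>C>0. \<forall>R>0. \<forall>u \<in> C1c (- (sing_set :: ((real^'k) \<times> (real^'m)) set)).
      supp u \<subseteq> ball 0 R \<times> UNIV \<longrightarrow>
      (\<integral>\<^sup>+x. ennreal (\<bar>u x\<bar> powr p /
            (norm (fst x) ^ k * ln (4 * R / norm (fst x)) powr p)) \<partial>lborel)
      \<le> ennreal C * (\<integral>\<^sup>+y. (\<integral>\<^sup>+x. ennreal (\<bar>u x - u y\<bar> powr p /
            norm (x - y) powr (real d + s * p) *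
            norm (fst x) powr \<alpha> * norm (fst y) powr \<beta>) \<partial>lborel) \<partial>lborel)"
proof -
  \<comment> \<open>The dimension \<open>k\<close> enters twice: once in d = k + (d - k) and once
    through sp = k + alpha + beta.\<close>
  have q: "real d + s * p = real (DIM(real^'k) + DIM(real^'m) + DIM(real^'k)) + \<alpha> + \<beta>"
    using assms by simp
  have "s * p \<ge> 0" using assms by (intro mult_nonneg_nonneg) auto
  then have "real d + s * p \<ge> 0" by simp
  from fractional_log_hardy[OF assms(2) this q] obtain C where C: "C > 0"
    and hardy: "\<forall>R>0. \<forall>u :: (real^'k) \<times> (real^'m) \<Rightarrow> real. u \<in> borel_measurable borel \<longrightarrow>
      (\<forall>x. u x \<noteq> 0 \<longrightarrow> fst x \<noteq> 0 \<and> norm (fst x) < R) \<longrightarrow>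
      (\<integral>\<^sup>+x. ennreal (\<bar>u x\<bar> powr p
        / (norm (fst x) ^ DIM(real^'k) * ln (4 * R / norm (fst x)) powr p)) \<partial>lborel)
      \<le> ennreal C * (\<integral>\<^sup>+y. (\<integral>\<^sup>+x. ennreal (weighted_kernel p (real d + s * p) \<alpha> \<beta> u x y) \<partial>lborel) \<partial>lborel)"
    by blast
  have "closed (sing_set :: ((real^'k) \<times> (real^'m)) set)"
    unfolding sing_set_def by (intro closed_Collect_eq continuous_intros)
  then have op: "open (- (sing_set :: ((real^'k) \<times> (real^'m)) set))" by auto
  show ?thesis
  proof (intro exI[of _ C] conjI allI impI ballI C)
    fix R :: real and u :: "(real^'k) \<times> (real^'m) \<Rightarrow> real"
    assume R: "R > 0" and u: "u \<in> C1c (- sing_set)" and S: "supp u \<subseteq> ball 0 R \<times> UNIV"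
    have nz: "fst x \<noteq> 0 \<and> norm (fst x) < R" if "u x \<noteq> 0" for x
    proof -
      have "x \<in> supp u" using that closure_subset[of "{x. u x \<noteq> 0}"] by (auto simp: supp_def)
      then show ?thesis using u S by (auto simp: C1c_def sing_set_def)
    qed
    show "(\<integral>\<^sup>+x. ennreal (\<bar>u x\<bar> powr p /
            (norm (fst x) ^ k * ln (4 * R / norm (fst x)) powr p)) \<partial>lborel)
      \<le> ennreal C * (\<integral>\<^sup>+y. (\<integral>\<^sup>+x. ennreal (\<bar>u x - u y\<bar> powr p /
            norm (x - y) powr (real d + s * p) *
            norm (fst x) powr \<alpha> * norm (fst y) powr \<beta>) \<partial>lborel) \<partial>lborel)"
      using hardy[rule_format, OF R C1c_borel_measurable[OF u op] nz] assms(7)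
      by (simp add: weighted_kernel_def)
  qed
qed

end
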